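(* Let $f=h+\overline{g}$ be a sense-preserving harmonic mapping in $\mathbb{D}$ with dilatation $\omega$, normalized by $J_f(0)=1$, and suppose that $|A_f(z)|\leq\alpha$ for all $z\in\mathbb{D}$. Consider the inequalities $$\frac{(1-|z|)^{2\alpha-2}}{(1+|z|)^{2\alpha+2}}\leq\frac{J_f(z)}{J_f(0)}\leq\frac{(1+|z|)^{2\alpha-2}}{(1-|z|)^{2\alpha+2}},\qquad z\in\mathbb{D}.\qquad( * )$$ (i) If there exists $z_0=re^{i\theta}\neq0$ in $\mathbb{D}$ (with $r=|z_0|$) at which equality holds in the right-hand inequality of $( * )$, and either $\omega(te^{i\theta})\in\mathbb{R}$ for all $0\leq t<1$ or $\omega$ is constant, then $$\frac{h''(z)}{h'(z)}=\frac{\omega(z)\omega'(z)}{1-\omega^2(z)}+2e^{-i\theta}\frac{\alpha+e^{-i\theta}z}{1-(e^{-i\theta}z)^2},\qquad z\in\mathbb{D}.$$ (ii) If there exists $z_0=re^{i\theta}\neq0$ in $\mathbb{D}$ (with $r=|z_0|$) at which equality holds in the left-hand inequality of $( * )$, and either $\omega(te^{i\theta})\in\mathbb{R}$ for all $0\leq t<1$ or $\omega$ is constant, then $$\frac{h''(z)}{h'(z)}=\frac{\omega(z)\omega'(z)}{1-\omega^2(z)}-2e^{-i\theta}\frac{\alpha-e^{-i\theta}z}{1-(e^{-i\theta}z)^2},\qquad z\in\mathbb{D}.$$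
   Context: $\mathbb{D}=\{z\in\mathbb{C}:|z|<1\}$. A (complex-valued) harmonic mapping $f$ in $\mathbb{D}$ is written $f=h+\overline{g}$ with $h,g$ analytic in $\mathbb{D}$. It is called sense-preserving if its Jacobian $J_f=|h'|^2-|g'|^2$ is positive throughout $\mathbb{D}$; then $h'\neq0$ in $\mathbb{D}$, and the (second complex) dilatation $\omega=g'/h'$ is analytic with $|\omega|<1$ in $\mathbb{D}$. For such $f$ define $$P_f=\partial_z\log J_f=\frac{h''}{h'}-\frac{\overline{\omega}\,\omega'}{1-|\omega|^2},\qquad A_f(z)=\frac{1-|z|^2}{2}P_f(z)-\overline{z},\quad z\in\mathbb{D}.$$ *)

theory Defs
  imports "HOL-Complex_Analysis.Complex_Analysis"
begin

text \<open>
  The Wirtinger derivatives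
  \<open>\<partial>\<^sub>z = (\<partial>\<^sub>x - \<i> \<partial>\<^sub>y) / 2\<close> and
  \<open>\<partial>\<^sub>z\<^sub>b\<^sub>a\<^sub>r = (\<partial>\<^sub>x + \<i> \<partial>\<^sub>y) / 2\<close>, where
  \<open>\<partial>\<^sub>x\<close> and \<open>\<partial>\<^sub>y\<close> are the values of the real
  derivative at the directions \<open>1\<close> and \<open>\<i>\<close>.
\<close>

definition wirtinger_dz :: "(complex \<Rightarrow> complex) \<Rightarrow> complex \<Rightarrow> complex" where
  "wirtinger_dz f z =
     (frechet_derivative f (at z) 1 - \<i> * frechet_derivative f (at z) \<i>) / 2"

definition wirtinger_dzbar :: "(complex \<Rightarrow> complex) \<Rightarrow> complex \<Rightarrow> complex" where
  "wirtinger_dzbar f z =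
     (frechet_derivative f (at z) 1 + \<i> * frechet_derivative f (at z) \<i>) / 2"

definition jacobian_det :: "(complex \<Rightarrow> complex) \<Rightarrow> complex \<Rightarrow> real" where
  "jacobian_det f z = (cmod (wirtinger_dz f z))\<^sup>2 - (cmod (wirtinger_dzbar f z))\<^sup>2"

definition harmonic_decomposition ::
  "(complex \<Rightarrow> complex) \<Rightarrow> (complex \<Rightarrow> complex) \<Rightarrow> (complex \<Rightarrow> complex) \<Rightarrow> bool" where
  "harmonic_decomposition f h g \<longleftrightarrow>
     h holomorphic_on ball 0 1 \<and> g holomorphic_on ball 0 1 \<and>
     (\<forall>z\<in>ball 0 1. f z = h z + cnj (g z))"

definition sense_preserving :: "(complex \<Rightarrow> complex) \<Rightarrow> bool" where
  "sense_preserving f \<longleftrightarrow> (\<forall>z\<in>ball 0 1. jacobian_det f z > 0)"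

definition dilatation ::
  "(complex \<Rightarrow> complex) \<Rightarrow> (complex \<Rightarrow> complex) \<Rightarrow> complex \<Rightarrow> complex" where
  "dilatation h g z = deriv g z / deriv h z"

definition P_op :: "(complex \<Rightarrow> complex) \<Rightarrow> complex \<Rightarrow> complex" where
  "P_op f z = wirtinger_dz (\<lambda>w. complex_of_real (ln (jacobian_det f w))) z"

definition A_op :: "(complex \<Rightarrow> complex) \<Rightarrow> complex \<Rightarrow> complex" where
  "A_op f z = complex_of_real ((1 - (cmod z)\<^sup>2) / 2) * P_op f z - cnj z"

lemma wirtinger_harmonic:
  assumes "harmonic_decomposition f h g" "z \<in> ball 0 1"
  shows "wirtinger_dz f z = deriv h z" "wirtinger_dzbar f z = cnj (deriv g z)"
proof -
  have h: "(h has_field_derivative deriv h z) (at z)"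
    and g: "(g has_field_derivative deriv g z) (at z)"
    using assms by (auto simp: harmonic_decomposition_def intro!: holomorphic_derivI)
  have "((\<lambda>w. h w + cnj (g w)) has_derivative
          (\<lambda>v. deriv h z * v + cnj (deriv g z * v))) (at z)"
    using h g unfolding has_field_derivative_def
    by (intro has_derivative_add has_derivative_cnj)
  then have "(f has_derivative (\<lambda>v. deriv h z * v + cnj (deriv g z * v))) (at z)"
    by (rule has_derivative_transform_within_open[where s = "ball 0 1"])
       (use assms in \<open>auto simp: harmonic_decomposition_def\<close>)
  then have "frechet_derivative f (at z) = (\<lambda>v. deriv h z * v + cnj (deriv g z * v))"
    by (rule frechet_derivative_at[symmetric])
  then show "wirtinger_dz f z = deriv h z" "wirtinger_dzbar f z = cnj (deriv g z)"
    by (simp_all add: wirtinger_dz_def wirtinger_dzbar_def complex_eq_iff)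
qed

lemma jacobian_det_harmonic:
  assumes "harmonic_decomposition f h g" "z \<in> ball 0 1"
  shows "jacobian_det f z = (cmod (deriv h z))\<^sup>2 - (cmod (deriv g z))\<^sup>2"
  by (simp add: jacobian_det_def wirtinger_harmonic[OF assms])

lemma P_op_harmonic:
  assumes f: "harmonic_decomposition f h g" and sp: "sense_preserving f"
    and z: "z \<in> ball 0 1"
  defines "\<omega> \<equiv> dilatation h g"
  shows "P_op f z = deriv (deriv h) z / deriv h z
           - cnj (\<omega> z) * deriv \<omega> z / (1 - complex_of_real ((cmod (\<omega> z))\<^sup>2))"
proof -
  define a where "a = deriv h z"
  define b where "b = deriv g z"
  define a' where "a' = deriv (deriv h) z"
  define b' where "b' = deriv (deriv g) z"
  have hol: "deriv h holomorphic_on ball 0 1" "deriv g holomorphic_on ball 0 1"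
    using f by (auto simp: harmonic_decomposition_def intro: holomorphic_deriv)
  have da: "(deriv h has_field_derivative a') (at z)"
    and db: "(deriv g has_field_derivative b') (at z)"
    unfolding a'_def b'_def using hol z by (auto intro!: holomorphic_derivI)
  define J where "J = (cmod a)\<^sup>2 - (cmod b)\<^sup>2"
  have J: "J > 0"
    using bspec[OF sp[unfolded sense_preserving_def] z] jacobian_det_harmonic[OF f z]
    by (simp add: J_def a_def b_def)
  then have a0: "a \<noteq> 0" by (auto simp: J_def)
  have dn: "((\<lambda>w. (cmod (F w))\<^sup>2) has_derivative (\<lambda>v. 2 * Re (cnj (F z) * (F' * v)))) (at z)"
    if "(F has_field_derivative F') (at z)" for F F'
  proof -
    have *: "(\<lambda>w. (cmod (F w))\<^sup>2) = (\<lambda>w. F w \<bullet> F w)"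
      by (simp add: power2_norm_eq_inner)
    show ?thesis
      using that unfolding has_field_derivative_def *
      by (auto intro!: derivative_eq_intros simp: inner_complex_def algebra_simps)
  qed
  have "((\<lambda>w. (cmod (deriv h w))\<^sup>2 - (cmod (deriv g w))\<^sup>2) has_derivative
          (\<lambda>v. 2 * Re (cnj a * (a' * v)) - 2 * Re (cnj b * (b' * v)))) (at z)"
    unfolding a_def b_def by (intro has_derivative_diff dn da db)
  then have dJ: "(jacobian_det f has_derivative
          (\<lambda>v. 2 * Re (cnj a * (a' * v)) - 2 * Re (cnj b * (b' * v)))) (at z)"
    by (rule has_derivative_transform_within_open[where s = "ball 0 1"])
       (use z jacobian_det_harmonic[OF f] in auto)
  have Jz: "jacobian_det f z = J"
    using jacobian_det_harmonic[OF f z] by (simp add: J_def a_def b_def)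
  have "((\<lambda>w. complex_of_real (ln (jacobian_det f w))) has_derivative
          (\<lambda>v. complex_of_real ((2 * Re (cnj a * (a' * v)) - 2 * Re (cnj b * (b' * v))) / J))) (at z)"
    using dJ J by (auto intro!: derivative_eq_intros simp: Jz field_simps)
  then have "frechet_derivative (\<lambda>w. complex_of_real (ln (jacobian_det f w))) (at z) =
          (\<lambda>v. complex_of_real ((2 * Re (cnj a * (a' * v)) - 2 * Re (cnj b * (b' * v))) / J))"
    by (rule frechet_derivative_at[symmetric])
  then have P: "P_op f z = (cnj a * a' - cnj b * b') / complex_of_real J"
    using J by (simp add: P_op_def wirtinger_dz_def complex_eq_iff field_simps)
  have "((\<lambda>w. deriv g w / deriv h w) has_field_derivative (b' * a - b * a') / (a * a)) (at z)"
    using DERIV_divide[OF db da] a0 by (simp add: a_def b_def)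
  then have w': "deriv \<omega> z = (b' * a - b * a') / (a * a)"
    unfolding \<omega>_def dilatation_def[abs_def] by (rule DERIV_imp_deriv)
  have w: "\<omega> z = b / a" by (simp add: \<omega>_def dilatation_def a_def b_def)
  have cJ: "complex_of_real J = a * cnj a - b * cnj b"
    by (simp add: J_def complex_norm_square del: of_real_power)
  have cJ0: "a * cnj a - b * cnj b \<noteq> 0" using J cJ by (metis less_irrefl of_real_eq_0_iff)
  have "1 - complex_of_real ((cmod (\<omega> z))\<^sup>2) = (a * cnj a - b * cnj b) / (a * cnj a)"
    unfolding complex_norm_square w using a0 by (simp add: divide_simps)
  then show ?thesis
    unfolding P cJ w w' a_def[symmetric] a'_def[symmetric]
    using a0 cJ0 by (simp add: divide_simps) (simp add: algebra_simps)
qed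

end

theory Submission
  imports Defs
begin

text \<open>
  The inequalities between \<open>J\<^sub>f(z)\<close> and the powers of \<open>1 \<plusminus> |z|\<close> come from integrating
  a differential inequality along a ray. For \<open>|u| = 1\<close>, the function
  \<open>t \<mapsto> ln J\<^sub>f(t u)\<close> has derivative \<open>2 Re (u P\<^sub>f(t u))\<close>, while \<open>|A\<^sub>f| \<le> \<alpha>\<close> says that
  \<open>(1 - t\<^sup>2)/2 \<sqdot> u P\<^sub>f(t u)\<close> lies in the closed disc of radius \<open>\<alpha>\<close> about \<open>t\<close>. The two extreme
  real parts in that disc, \<open>t + \<alpha>\<close> and \<open>t - \<alpha>\<close>, are attained only at these two points.

  Equality of the integrated inequality at \<open>r u\<close> forces equality of the derivatives on all of
  \<open>(0, r)\<close>, hence an extreme real part, hence the exact complex value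
  \<open>u P\<^sub>f(t u) = 2 (t + \<beta>) / (1 - t\<^sup>2)\<close> with \<open>\<beta> = \<alpha>\<close> for the upper and \<open>\<beta> = -\<alpha>\<close> for the lower
  bound (lemma \<open>P_op_on_extremal_ray\<close>). Replacing \<open>\<alpha>\<close> by \<open>-\<alpha>\<close> exchanges the two bounds,
  so one argument serves both.

  The term \<open>cnj \<omega> \<sqdot> \<omega>' / (1 - |\<omega>|\<^sup>2)\<close> of \<open>P\<^sub>f\<close> is rarely analytic. If \<open>\<omega>\<close> is real on the ray, it
  agrees there with \<open>\<omega> \<omega>' / (1 - \<omega>\<^sup>2)\<close>, and if \<open>\<omega>\<close> is constant, both vanish. In either case the
  formula on the ray is an identity between functions analytic in the disc, and the identity theorem
  extends it (lemma \<open>pre_schwarzian_of_extremal_ray\<close>).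
\<close>

section \<open>Derivatives along a ray\<close>

text \<open>
  For real-valued \<open>\<phi>\<close> the two Wirtinger derivatives are conjugate to each other, so the
  directional derivative \<open>u \<partial>\<^sub>z\<phi> + cnj u \<sqdot> cnj (\<partial>\<^sub>z\<phi>)\<close> is twice a real part.
\<close>

lemma has_real_derivative_along_ray:
  fixes \<phi> :: "complex \<Rightarrow> real"
  assumes "\<phi> differentiable (at (of_real t * u))"
  shows "((\<lambda>t. \<phi> (of_real t * u)) has_real_derivative
           2 * Re (u * wirtinger_dz (\<lambda>w. of_real (\<phi> w)) (of_real t * u))) (at t)"
proof -
  let ?z = "of_real t * u"
  obtain D where D: "(\<phi> has_derivative D) (at ?z)"
    using assms by (auto simp: differentiable_def)
  then interpret D: bounded_linear D by (rule has_derivative_bounded_linear)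
  have D_split: "D v = Re v * D 1 + Im v * D \<i>" for v
  proof -
    have "v = Re v *\<^sub>R 1 + Im v *\<^sub>R \<i>" by (simp add: complex_eq_iff)
    then show ?thesis by (metis D.add D.scaleR real_scaleR_def)
  qed
  have "((\<lambda>w. complex_of_real (\<phi> w)) has_derivative (\<lambda>v. of_real (D v))) (at ?z)"
    by (intro has_derivative_of_real D)
  then have "frechet_derivative (\<lambda>w. complex_of_real (\<phi> w)) (at ?z) = (\<lambda>v. of_real (D v))"
    by (rule frechet_derivative_at[symmetric])
  then have Du: "D u = 2 * Re (u * wirtinger_dz (\<lambda>w. of_real (\<phi> w)) ?z)"
    by (simp add: wirtinger_dz_def D_split[of u])
  have "((\<lambda>t. of_real t * u) has_derivative (\<lambda>s. of_real s * u)) (at t)"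
    by (auto intro!: derivative_eq_intros)
  from diff_chain_at[OF this D]
  have "((\<lambda>t. \<phi> (of_real t * u)) has_derivative (\<lambda>s. D (of_real s * u))) (at t)"
    by (simp add: o_def)
  moreover have "(\<lambda>s. D (of_real s * u)) = (\<lambda>s. D u * s)"
    by (simp add: D.scaleR[unfolded scaleR_conv_of_real] mult.commute[of "D u"])
  ultimately show ?thesis
    by (simp add: has_field_derivative_def Du)
qed

text \<open>
  Such an \<open>F\<close> is nondecreasing, hence constant, and every interior point is a local maximum.
\<close>

lemma nonneg_derivative_eq_0_if_equal_endpoints:
  fixes F F' :: "real \<Rightarrow> real"
  assumes der: "\<And>t. a \<le> t \<Longrightarrow> t \<le> b \<Longrightarrow> (F has_real_derivative F' t) (at t)"
    and nonneg: "\<And>t. a \<le> t \<Longrightarrow> t \<le> b \<Longrightarrow> 0 \<le> F' t"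
    and ends: "F a = F b" and t: "a < t" "t < b"
  shows "F' t = 0"
proof -
  have mono: "F x \<le> F y" if "a \<le> x" "x \<le> y" "y \<le> b" for x y
    using that by (intro DERIV_nonneg_imp_nondecreasing[of x y F])
      (auto intro: exI[of _ "F' _"] der nonneg order_trans)
  have "F y \<le> F t" if "\<bar>t - y\<bar> < min (t - a) (b - t)" for y
  proof -
    have "F y \<le> F b" using that by (intro mono) auto
    also have "F b \<le> F t" unfolding ends[symmetric] using t by (intro mono) auto
    finally show ?thesis .
  qed
  then show ?thesis
    using t by (intro DERIV_local_max[OF der[of t], of "min (t - a) (b - t)"]) auto
qed

lemma differentiable_ln_jacobian_det:
  assumes f: "harmonic_decomposition f h g" and sp: "sense_preserving f"
    and z: "z \<in> ball 0 1"
  shows "(\<lambda>w. ln (jacobian_det f w)) differentiable (at z)"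
proof -
  have norm_sq: "(\<lambda>w. (cmod (deriv F w))\<^sup>2) differentiable (at z)" if "F holomorphic_on ball 0 1" for F
  proof -
    have "(deriv F has_derivative (*) (deriv (deriv F) z)) (at z)"
      using holomorphic_derivI[OF holomorphic_deriv[OF that open_ball] open_ball z]
      by (simp add: has_field_derivative_def)
    then show ?thesis
      unfolding power2_norm_eq_inner differentiable_def by (blast intro: has_derivative_inner)
  qed
  have "(\<lambda>w. (cmod (deriv h w))\<^sup>2 - (cmod (deriv g w))\<^sup>2) differentiable (at z)"
    using f by (intro differentiable_diff norm_sq) (auto simp: harmonic_decomposition_def)
  then obtain D where
    "((\<lambda>w. (cmod (deriv h w))\<^sup>2 - (cmod (deriv g w))\<^sup>2) has_derivative D) (at z)"
    by (auto simp: differentiable_def)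
  then have "(jacobian_det f has_derivative D) (at z)"
    by (rule has_derivative_transform_within_open[where s = "ball 0 1"])
       (use z jacobian_det_harmonic[OF f] in auto)
  moreover have "jacobian_det f z > 0"
    using sp z by (simp add: sense_preserving_def)
  ultimately show ?thesis
    unfolding differentiable_def by (blast intro: has_derivative_ln)
qed

section \<open>Equality in the distortion bounds\<close>

text \<open>
  With \<open>\<sigma> = 1\<close> the hypothesis \<open>extremal\<close> is equality in the upper bound for \<open>J\<^sub>f\<close>, with
  \<open>\<sigma> = -1\<close> it is equality in the lower one. The right side of \<open>extremal\<close> minus the left side,
  as a function of \<open>r\<close>, is nondecreasing for \<open>\<sigma> = 1\<close> and nonincreasing for \<open>\<sigma> = -1\<close>, and it
  vanishes at \<open>0\<close>. Since it also vanishes at \<open>r\<close>, its derivative is zero in between. This leaves a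
  point of the disc \<open>|w| \<le> \<alpha>\<close> with real part \<open>\<sigma> \<alpha>\<close>, and \<open>\<sigma> \<alpha>\<close> is the only such point.
\<close>

lemma P_op_on_extremal_ray:
  fixes \<alpha> \<sigma> r :: real
  defines "\<beta> \<equiv> \<sigma> * \<alpha>"
  assumes f: "harmonic_decomposition f h g" and sp: "sense_preserving f"
    and normalized: "jacobian_det f 0 = 1"
    and bound: "\<And>z. z \<in> ball 0 1 \<Longrightarrow> cmod (A_op f z) \<le> \<alpha>"
    and \<sigma>: "\<sigma> = 1 \<or> \<sigma> = -1" and u: "cmod u = 1" and r: "r < 1"
    and extremal: "ln (jacobian_det f (of_real r * u))
                     = (2 * \<beta> - 2) * ln (1 + r) - (2 * \<beta> + 2) * ln (1 - r)"
    and t: "0 < t" "t < r"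
  shows "P_op f (of_real t * u) = 2 * cnj u * ((of_real \<beta> + of_real t) / (1 - (of_real t)\<^sup>2))"
proof -
  define L where "L = (\<lambda>t. ln (jacobian_det f (of_real t * u)))"
  define \<Phi> where "\<Phi> = (\<lambda>t. (2 * \<beta> - 2) * ln (1 + t) - (2 * \<beta> + 2) * ln (1 - t))"
  \<comment> \<open>\<open>w t\<close> is \<open>A_op f\<close> rotated so that its real part governs the derivative along the ray.\<close>
  define w where "w = (\<lambda>t. of_real ((1 - t\<^sup>2) / 2) * (u * P_op f (of_real t * u)) - of_real t)"
  have ucnj: "u * cnj u = 1"
    using u by (simp add: complex_norm_square[symmetric])
  have in_ball: "of_real t * u \<in> ball 0 1" if "0 \<le> t" "t \<le> r" for t
    using that r u by (simp add: norm_mult)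
  have w_bound: "cmod (w t) \<le> \<alpha>" if "0 \<le> t" "t \<le> r" for t
  proof -
    have cnj_z: "u * cnj (of_real t * u) = of_real t"
      using ucnj by (simp add: mult.left_commute)
    have "w t = u * A_op f (of_real t * u)"
      using u that unfolding w_def A_op_def right_diff_distrib cnj_z
      by (simp add: norm_mult mult.left_commute)
    then show ?thesis
      using bound[OF in_ball[OF that]] u by (simp add: norm_mult)
  qed
  have scale: "\<sigma> * (c * (\<beta> + s) - c * (x + s)) = c * (\<alpha> - \<sigma> * x)" for c s x :: real
    using \<sigma> by (auto simp: \<beta>_def algebra_simps)
  have der: "((\<lambda>t. \<sigma> * (\<Phi> t - L t)) has_real_derivative
               4 / (1 - t\<^sup>2) * (\<alpha> - \<sigma> * Re (w t))) (at t)" if t: "0 \<le> t" "t \<le> r" for t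
  proof -
    have "t < 1" using t r by simp
    then have pos: "1 - t\<^sup>2 > 0"
      using t by (simp add: power_less_one_iff abs_square_less_1)
    have L': "(L has_real_derivative 2 * Re (u * P_op f (of_real t * u))) (at t)"
      unfolding L_def P_op_def
      by (intro has_real_derivative_along_ray differentiable_ln_jacobian_det[OF f sp] in_ball t)
    have "(\<Phi> has_real_derivative (2 * \<beta> - 2) / (1 + t) + (2 * \<beta> + 2) / (1 - t)) (at t)"
      unfolding \<Phi>_def using t \<open>t < 1\<close>
      by (auto intro!: derivative_eq_intros simp: divide_simps) (simp add: algebra_simps)
    moreover have "(2 * \<beta> - 2) / (1 + t) + (2 * \<beta> + 2) / (1 - t) = 4 / (1 - t\<^sup>2) * (\<beta> + t)"
      using t \<open>t < 1\<close> pos by (simp add: divide_simps) (simp add: power2_eq_square algebra_simps)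
    moreover have "2 * Re (u * P_op f (of_real t * u)) = 4 / (1 - t\<^sup>2) * (Re (w t) + t)"
      using pos by (simp add: w_def)
    ultimately have "((\<lambda>t. \<sigma> * (\<Phi> t - L t)) has_real_derivative
        \<sigma> * (4 / (1 - t\<^sup>2) * (\<beta> + t) - 4 / (1 - t\<^sup>2) * (Re (w t) + t))) (at t)"
      using L' by (auto intro!: derivative_eq_intros)
    also have "\<sigma> * (4 / (1 - t\<^sup>2) * (\<beta> + t) - 4 / (1 - t\<^sup>2) * (Re (w t) + t))
        = 4 / (1 - t\<^sup>2) * (\<alpha> - \<sigma> * Re (w t))"
      by (rule scale)
    finally show ?thesis .
  qed
  have nonneg: "0 \<le> 4 / (1 - t\<^sup>2) * (\<alpha> - \<sigma> * Re (w t))" if "0 \<le> t" "t \<le> r" for t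
  proof -
    have "\<sigma> * Re (w t) \<le> \<alpha>"
      using \<sigma> w_bound[OF that] abs_Re_le_cmod[of "w t"] by auto
    moreover have "t\<^sup>2 \<le> 1"
      using that r by (simp add: power_le_one)
    ultimately show ?thesis by simp
  qed
  have "4 / (1 - t\<^sup>2) * (\<alpha> - \<sigma> * Re (w t)) = 0"
    by (rule nonneg_derivative_eq_0_if_equal_endpoints[OF der nonneg _ t])
       (use extremal normalized in \<open>auto simp: \<Phi>_def L_def\<close>)
  moreover have t2: "t\<^sup>2 < 1"
    using t r by (simp add: abs_square_less_1)
  ultimately have Re_w: "Re (w t) = \<beta>"
    using \<sigma> by (auto simp: \<beta>_def)
  have "(Re (w t))\<^sup>2 + (Im (w t))\<^sup>2 \<le> \<alpha>\<^sup>2"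
    using power_mono[OF w_bound[of t] norm_ge_zero, of 2] t by (simp add: cmod_power2)
  moreover have "\<beta>\<^sup>2 = \<alpha>\<^sup>2"
    using \<sigma> by (auto simp: \<beta>_def)
  ultimately have "w t = of_real \<beta>"
    using Re_w by (simp add: complex_eq_iff)
  moreover have "1 - (complex_of_real t)\<^sup>2 \<noteq> 0"
    using t2 by (metis less_irrefl of_real_1 of_real_eq_iff of_real_power right_minus_eq)
  moreover have "w t = (1 - (of_real t)\<^sup>2) * (u * P_op f (of_real t * u)) / 2 - of_real t"
    by (simp add: w_def)
  ultimately have "u * P_op f (of_real t * u)
      = 2 * ((of_real \<beta> + of_real t) / (1 - (of_real t)\<^sup>2))"
    by (simp add: eq_divide_eq diff_eq_eq mult.commute)
  then have "(u * cnj u) * P_op f (of_real t * u)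
      = 2 * cnj u * ((of_real \<beta> + of_real t) / (1 - (of_real t)\<^sup>2))"
    by (metis mult.assoc mult.commute)
  then show ?thesis
    by (simp add: ucnj)
qed

section \<open>From the ray to the disc\<close>

lemma zero_islimpt_open_ray:
  fixes u :: complex
  assumes "u \<noteq> 0" "0 < r"
  shows "0 islimpt (\<lambda>t. of_real t * u) ` {0<..<r}"
  unfolding islimpt_approachable
proof (intro allI impI)
  fix e :: real assume "0 < e"
  define t where "t = min r (e / cmod u) / 2"
  have t: "0 < t" "t < r" "t < e / cmod u"
    using assms \<open>0 < e\<close> by (auto simp: t_def min_def field_simps)
  then have "of_real t * u \<in> (\<lambda>t. of_real t * u) ` {0<..<r}" "of_real t * u \<noteq> 0"
    "dist (of_real t * u) 0 < e"
    using assms by (auto simp: norm_mult field_simps)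
  then show "\<exists>x'\<in>(\<lambda>t. of_real t * u) ` {0<..<r}. x' \<noteq> 0 \<and> dist x' 0 < e"
    by blast
qed

text \<open>
  Subtracting the two sides gives a function \<open>E\<close> that is analytic in the disc because \<open>h'\<close> has no zeros and \<open>|\<omega>| < 1\<close>,
  and \<open>E\<close> vanishes on the ray once \<open>cnj \<omega>\<close> can be replaced by \<open>\<omega>\<close> there. Substituting
  \<open>cnj u \<sqdot> z\<close> for \<open>t\<close> is what makes the right-hand side analytic in \<open>z\<close>.
\<close>

lemma pre_schwarzian_of_extremal_ray:
  fixes \<beta> r :: real
  assumes f: "harmonic_decomposition f h g" and sp: "sense_preserving f"
    and dil: "\<omega> = dilatation h g"
    and u: "cmod u = 1" and r: "0 < r" "r < 1"
    and P: "\<And>t. 0 < t \<Longrightarrow> t < r \<Longrightarrow>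
      P_op f (of_real t * u) = 2 * cnj u * ((of_real \<beta> + of_real t) / (1 - (of_real t)\<^sup>2))"
    and \<omega>: "(\<forall>t. 0 \<le> t \<and> t < 1 \<longrightarrow> \<omega> (of_real t * u) \<in> \<real>) \<or> \<omega> constant_on ball 0 1"
    and z: "z \<in> ball 0 1"
  shows "deriv (deriv h) z / deriv h z
           = \<omega> z * deriv \<omega> z / (1 - (\<omega> z)\<^sup>2)
             + 2 * cnj u * ((of_real \<beta> + cnj u * z) / (1 - (cnj u * z)\<^sup>2))"
proof -
  let ?D = "ball 0 1 :: complex set"
  have hol: "deriv h holomorphic_on ?D" "deriv g holomorphic_on ?D"
    using f by (auto simp: harmonic_decomposition_def intro: holomorphic_deriv)
  have J: "cmod (deriv g z) < cmod (deriv h z)" if "z \<in> ?D" for z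
  proof -
    have "(cmod (deriv g z))\<^sup>2 < (cmod (deriv h z))\<^sup>2"
      using bspec[OF sp[unfolded sense_preserving_def] that] jacobian_det_harmonic[OF f that]
      by simp
    then show ?thesis by (rule power2_less_imp_less) simp
  qed
  then have h0: "deriv h z \<noteq> 0" if "z \<in> ?D" for z
    using that by force
  have \<omega>_less: "cmod (\<omega> z) < 1" if "z \<in> ?D" for z
    using J[OF that] h0[OF that] by (simp add: dil dilatation_def norm_divide)
  have square_neq_1: "1 - w\<^sup>2 \<noteq> 0" if "cmod w < 1" for w :: complex
    using that power2_eq_1_iff[of w] by auto
  have hol_\<omega>: "\<omega> holomorphic_on ?D"
    unfolding dil dilatation_def[abs_def] using h0 by (intro holomorphic_intros hol)
  define E where "E = (\<lambda>z. deriv (deriv h) z / deriv h z - \<omega> z * deriv \<omega> z / (1 - (\<omega> z)\<^sup>2)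
      - 2 * cnj u * ((of_real \<beta> + cnj u * z) / (1 - (cnj u * z)\<^sup>2)))"
  have "E holomorphic_on ?D"
  proof -
    have "1 - (cnj u * z)\<^sup>2 \<noteq> 0" if "z \<in> ?D" for z
      using that u by (intro square_neq_1) (simp add: norm_mult)
    then show ?thesis
      unfolding E_def
      by (intro holomorphic_on_diff holomorphic_on_add holomorphic_on_mult holomorphic_on_divide
          holomorphic_on_power holomorphic_on_const holomorphic_on_ident holomorphic_deriv hol hol_\<omega>
          open_ball h0 square_neq_1[OF \<omega>_less])
  qed
  moreover have "E (of_real t * u) = 0" if t: "0 < t" "t < r" for t
  proof -
    let ?z = "of_real t * u"
    have zD: "?z \<in> ?D"
      using t r u by (simp add: norm_mult)
    have cnj_z: "cnj u * ?z = of_real t"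
      using u by (simp add: mult.left_commute mult.commute[of "cnj u"] complex_norm_square[symmetric])
    have \<omega>_term: "cnj (\<omega> ?z) * deriv \<omega> ?z / (1 - of_real ((cmod (\<omega> ?z))\<^sup>2))
        = \<omega> ?z * deriv \<omega> ?z / (1 - (\<omega> ?z)\<^sup>2)"
      using \<omega>
    proof
      assume "\<forall>t. 0 \<le> t \<and> t < 1 \<longrightarrow> \<omega> (of_real t * u) \<in> \<real>"
      then have "cnj (\<omega> ?z) = \<omega> ?z"
        using t r by (simp add: Reals_cnj_iff)
      then show ?thesis
        unfolding complex_norm_square by (simp add: power2_eq_square)
    next
      assume "\<omega> constant_on ?D"
      then obtain c where c: "\<And>w. w \<in> ?D \<Longrightarrow> \<omega> w = c"
        by (auto simp: constant_on_def)
      have "(\<omega> has_field_derivative 0) (at ?z)"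
        by (rule has_field_derivative_transform_within_open[of "\<lambda>_. c" _ _ ?D])
           (use c zD in auto)
      then show ?thesis
        by (simp add: DERIV_imp_deriv)
    qed
    show ?thesis
      using P[OF t] P_op_harmonic[OF f sp zD]
      unfolding E_def cnj_z \<omega>_term[symmetric] by (simp add: dil)
  qed
  \<comment> \<open>The points of the ray accumulate at the centre of the disc.\<close>
  ultimately have "E z = 0"
    using u r by (intro analytic_continuation[of E ?D "(\<lambda>t. of_real t * u) ` {0<..<r}" 0 z]
        zero_islimpt_open_ray z) (auto simp: norm_mult)
  then show ?thesis
    by (simp add: E_def diff_diff_eq)
qed

theorem proposition4:
  fixes f h g :: "complex \<Rightarrow> complex" and \<omega> :: "complex \<Rightarrow> complex" and \<alpha> :: real
  assumes decomp: "harmonic_decomposition f h g"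
    and sense: "sense_preserving f"
    and dil: "\<omega> = dilatation h g"
    and normalized: "jacobian_det f 0 = 1"
    and bound: "\<forall>z\<in>ball 0 1. cmod (A_op f z) \<le> \<alpha>"
  shows
    "(\<forall>z0\<in>ball 0 1. \<forall>r \<theta>.
        z0 \<noteq> 0 \<and> r = cmod z0 \<and> z0 = of_real r * cis \<theta> \<and>
        jacobian_det f z0 / jacobian_det f 0
          = (1 + cmod z0) powr (2 * \<alpha> - 2) / (1 - cmod z0) powr (2 * \<alpha> + 2) \<and>
        ((\<forall>t. 0 \<le> t \<and> t < 1 \<longrightarrow> \<omega> (of_real t * cis \<theta>) \<in> \<real>) \<or> \<omega> constant_on ball 0 1)
      \<longrightarrow> (\<forall>z\<in>ball 0 1.
            deriv (deriv h) z / deriv h z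
              = \<omega> z * deriv \<omega> z / (1 - (\<omega> z)\<^sup>2)
                + 2 * cis (- \<theta>) * ((of_real \<alpha> + cis (- \<theta>) * z) / (1 - (cis (- \<theta>) * z)\<^sup>2))))
     \<and>
     (\<forall>z0\<in>ball 0 1. \<forall>r \<theta>.
        z0 \<noteq> 0 \<and> r = cmod z0 \<and> z0 = of_real r * cis \<theta> \<and>
        jacobian_det f z0 / jacobian_det f 0
          = (1 - cmod z0) powr (2 * \<alpha> - 2) / (1 + cmod z0) powr (2 * \<alpha> + 2) \<and>
        ((\<forall>t. 0 \<le> t \<and> t < 1 \<longrightarrow> \<omega> (of_real t * cis \<theta>) \<in> \<real>) \<or> \<omega> constant_on ball 0 1)
      \<longrightarrow> (\<forall>z\<in>ball 0 1.
            deriv (deriv h) z / deriv h z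
              = \<omega> z * deriv \<omega> z / (1 - (\<omega> z)\<^sup>2)
                - 2 * cis (- \<theta>) * ((of_real \<alpha> - cis (- \<theta>) * z) / (1 - (cis (- \<theta>) * z)\<^sup>2))))"
proof -
  have rigid: "deriv (deriv h) z / deriv h z
      = \<omega> z * deriv \<omega> z / (1 - (\<omega> z)\<^sup>2)
        + 2 * cis (- \<theta>) * ((of_real (\<sigma> * \<alpha>) + cis (- \<theta>) * z) / (1 - (cis (- \<theta>) * z)\<^sup>2))"
    if "\<sigma> = 1 \<or> \<sigma> = -1" "0 < r" "r < 1" "z \<in> ball 0 1"
      "ln (jacobian_det f (of_real r * cis \<theta>))
         = (2 * (\<sigma> * \<alpha>) - 2) * ln (1 + r) - (2 * (\<sigma> * \<alpha>) + 2) * ln (1 - r)"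
      "(\<forall>t. 0 \<le> t \<and> t < 1 \<longrightarrow> \<omega> (of_real t * cis \<theta>) \<in> \<real>) \<or> \<omega> constant_on ball 0 1"
    for \<sigma> r \<theta> z
    using pre_schwarzian_of_extremal_ray[OF decomp sense dil, of "cis \<theta>" r "\<sigma> * \<alpha>" z]
      P_op_on_extremal_ray[OF decomp sense normalized, of \<alpha> \<sigma> "cis \<theta>" r] bound that
    by (simp add: cis_cnj)
  have ln_quot: "ln (a powr p / b powr q) = p * ln a - q * ln b" if "0 < a" "0 < b" for a b p q :: real
    using that by (simp add: ln_div ln_powr)
  show ?thesis
  proof (intro conjI ballI allI impI; elim conjE)
    fix z0 z :: complex and r \<theta> :: real
    assume z0: "z0 \<in> ball 0 1" "z0 \<noteq> 0" "r = cmod z0" "z0 = of_real r * cis \<theta>"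
      and z: "z \<in> ball 0 1"
      and eq: "jacobian_det f z0 / jacobian_det f 0
          = (1 + cmod z0) powr (2 * \<alpha> - 2) / (1 - cmod z0) powr (2 * \<alpha> + 2)"
      and \<omega>: "(\<forall>t. 0 \<le> t \<and> t < 1 \<longrightarrow> \<omega> (of_real t * cis \<theta>) \<in> \<real>) \<or> \<omega> constant_on ball 0 1"
    have r: "0 < r" "r < 1"
      using z0(1-3) by auto
    have "jacobian_det f (of_real r * cis \<theta>) = (1 + r) powr (2 * \<alpha> - 2) / (1 - r) powr (2 * \<alpha> + 2)"
      using eq normalized unfolding z0(4)[symmetric] z0(3)[symmetric] by simp
    then have "ln (jacobian_det f (of_real r * cis \<theta>))
        = (2 * \<alpha> - 2) * ln (1 + r) - (2 * \<alpha> + 2) * ln (1 - r)"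
      using r by (simp only: ln_quot)
    then show "deriv (deriv h) z / deriv h z
        = \<omega> z * deriv \<omega> z / (1 - (\<omega> z)\<^sup>2)
          + 2 * cis (- \<theta>) * ((of_real \<alpha> + cis (- \<theta>) * z) / (1 - (cis (- \<theta>) * z)\<^sup>2))"
      using rigid[of 1 r z \<theta>] r z \<omega> by simp
  next
    fix z0 z :: complex and r \<theta> :: real
    assume z0: "z0 \<in> ball 0 1" "z0 \<noteq> 0" "r = cmod z0" "z0 = of_real r * cis \<theta>"
      and z: "z \<in> ball 0 1"
      and eq: "jacobian_det f z0 / jacobian_det f 0
          = (1 - cmod z0) powr (2 * \<alpha> - 2) / (1 + cmod z0) powr (2 * \<alpha> + 2)"
      and \<omega>: "(\<forall>t. 0 \<le> t \<and> t < 1 \<longrightarrow> \<omega> (of_real t * cis \<theta>) \<in> \<real>) \<or> \<omega> constant_on ball 0 1"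
    have r: "0 < r" "r < 1"
      using z0(1-3) by auto
    have "jacobian_det f (of_real r * cis \<theta>) = (1 - r) powr (2 * \<alpha> - 2) / (1 + r) powr (2 * \<alpha> + 2)"
      using eq normalized unfolding z0(4)[symmetric] z0(3)[symmetric] by simp
    then have "ln (jacobian_det f (of_real r * cis \<theta>))
        = (2 * \<alpha> - 2) * ln (1 - r) - (2 * \<alpha> + 2) * ln (1 + r)"
      using r by (simp only: ln_quot)
    also have "\<dots> = (2 * (-1 * \<alpha>) - 2) * ln (1 + r) - (2 * (-1 * \<alpha>) + 2) * ln (1 - r)"
      by (simp add: algebra_simps)
    finally have "deriv (deriv h) z / deriv h z
        = \<omega> z * deriv \<omega> z / (1 - (\<omega> z)\<^sup>2)
          + 2 * cis (- \<theta>) * ((of_real (-1 * \<alpha>) + cis (- \<theta>) * z) / (1 - (cis (- \<theta>) * z)\<^sup>2))"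
      using r z \<omega> by (intro rigid) auto
    also have "(of_real (-1 * \<alpha>) + cis (- \<theta>) * z) / (1 - (cis (- \<theta>) * z)\<^sup>2)
        = - ((of_real \<alpha> - cis (- \<theta>) * z) / (1 - (cis (- \<theta>) * z)\<^sup>2))"
      by (simp add: minus_divide_left)
    finally show "deriv (deriv h) z / deriv h z
        = \<omega> z * deriv \<omega> z / (1 - (\<omega> z)\<^sup>2)
          - 2 * cis (- \<theta>) * ((of_real \<alpha> - cis (- \<theta>) * z) / (1 - (cis (- \<theta>) * z)\<^sup>2))"
      by simp
  qed
qed

end
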